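(* Consider a fully-connected monDEQ with parameters $\mathbf{W}\in\mathbb{R}^{p\times p}$, $\mathbf{U}\in\mathbb{R}^{p\times p_0}$, $\mathbf{u}\in\mathbb{R}^p$, $\mathbf{C}\in\mathbb{R}^{K\times p}$, $\mathbf{c}\in\mathbb{R}^K$ (as in the context), $\mathbf{x}_0\in\mathbb{R}^{p_0}$, $\varepsilon>0$, and $q=2$ or $q=\infty$. The following two problems are equivalent, in the sense that they have the same feasible tuples $(\mathbf{Q},\mathbf{b},\sigma_1,\sigma_2,\sigma_3,\tau)$ and their objectives correspond via the logarithm (with $\log 0=-\infty$). (i) Maximize $\det(\mathbf{Q})$ over $\mathbf{Q}\in\mathbb{S}^K$, $\mathbf{b}\in\mathbb{R}^K$, $\sigma_1\ge0$, $\sigma_2\in\mathbb{R}^p_{\ge0}$, $\sigma_3\in\mathbb{R}^p_{\ge0}$, $\tau\in\mathbb{R}^p$ such that there is a sum-of-squares polynomial $\sigma_0(\mathbf{x},\mathbf{z})$ of degree at most $2$ with, identically in $(\mathbf{x},\mathbf{z})\in\mathbb{R}^{p_0}\times\mathbb{R}^p$, $$1-\|\mathbf{Q}(\mathbf{C}\mathbf{z}+\mathbf{c})+\mathbf{b}\|_2^2=\sigma_0(\mathbf{x},\mathbf{z})+\sigma_1^Tg_q(\mathbf{x}-\mathbf{x}_0)+\tau^T\big(\mathbf{z}(\mathbf{z}-\mathbf{W}\mathbf{z}-\mathbf{U}\mathbf{x}-\mathbf{u})\big)+\sigma_2^T(\mathbf{z}-\mathbf{W}\mathbf{z}-\mathbf{U}\mathbf{x}-\mathbf{u})+\sigma_3^T\mathbf{z}.$$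 (ii) Maximize $\log\det(\mathbf{Q})$ over $\mathbf{Q}\in\mathbb{S}^K$, $\mathbf{b}\in\mathbb{R}^K$, $\sigma_1,\sigma_2,\sigma_3\ge0$, $\tau\in\mathbb{R}^p$ subject to $-\mathbf{M}\succeq0$, where $\mathbf{M}$ is the symmetric $(p_0+p+1)\times(p_0+p+1)$ matrix, determined by $(\mathbf{Q},\mathbf{b})$, $(\sigma_1,\sigma_2,\sigma_3,\tau)$ and the network parameters (and $\mathbf{x}_0,\varepsilon$), which is the Gram matrix in the basis $(\mathbf{x}^T,\mathbf{z}^T,1)$ of the quadratic polynomial $$f(\mathbf{x},\mathbf{z})=\|\mathbf{Q}(\mathbf{C}\mathbf{z}+\mathbf{c})+\mathbf{b}\|_2^2-1+\sigma_1^Tg_q(\mathbf{x}-\mathbf{x}_0)+\tau^T\big(\mathbf{z}(\mathbf{z}-\mathbf{W}\mathbf{z}-\mathbf{U}\mathbf{x}-\mathbf{u})\big)+\sigma_2^T(\mathbf{z}-\mathbf{W}\mathbf{z}-\mathbf{U}\mathbf{x}-\mathbf{u})+\sigma_3^T\mathbf{z}.$$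
   Context: A fully-connected monDEQ is the map $F(\mathbf{x})=\mathbf{C}\mathbf{z}+\mathbf{c}$ with $\mathbf{z}=\mathrm{ReLU}(\mathbf{W}\mathbf{z}+\mathbf{U}\mathbf{x}+\mathbf{u})$, $\mathrm{ReLU}(x)=\max\{0,x\}$ coordinate-wise, where for some $m>0$ one has $\mathbf{a}^T(\mathbf{I}_p-\mathbf{W})\mathbf{a}\ge m\|\mathbf{a}\|_2^2$ for all $\mathbf{a}\in\mathbb{R}^p$. $\mathbb{S}^K$ is the set of symmetric positive semidefinite $K\times K$ real matrices, and $\succeq0$ means positive semidefinite. For vectors $\mathbf{a},\mathbf{b}\in\mathbb{R}^p$, the juxtaposition $\mathbf{a}\mathbf{b}$ denotes the coordinate-wise product, so $\mathbf{z}(\mathbf{z}-\mathbf{W}\mathbf{z}-\mathbf{U}\mathbf{x}-\mathbf{u})\in\mathbb{R}^p$. For $q=2$: $g_2(\mathbf{x})=\varepsilon^2-\|\mathbf{x}\|_2^2$ (a scalar) and $\sigma_1\in\mathbb{R}_{\ge0}$. For $q=\infty$: $g_\infty(\mathbf{x})\in\mathbb{R}^{p_0}$ is the vector with entries $\varepsilon^2-x_i^2$ and $\sigma_1\in\mathbb{R}_{\ge0}^{p_0}$. Inequalities on vectors are coordinate-wise. A polynomial is a sum of squares if it is a finite sum of squares of real polynomials. The symmetric Gram matrix of a polynomial $f(\mathbf{x},\mathbf{z})$ of degree at most $2$ in the basis $(\mathbf{x}^T,\mathbf{z}^T,1)$ is the unique symmetric matrix $\mathbf{M}$ with $f(\mathbf{x},\mathbf{z})=\mathbf{v}^T\mathbf{M}\mathbf{v}$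 for all $\mathbf{x},\mathbf{z}$, where $\mathbf{v}=(\mathbf{x}^T,\mathbf{z}^T,1)^T$. *)

theory Defs
  imports "HOL-Analysis.Analysis" "HOL-Library.Poly_Mapping"
begin

section \<open>Monotone operator deep equilibrium networks\<close>

definition relu :: "real^'p \<Rightarrow> real^'p" where
  "relu a = (\<chi> i. max 0 (a $ i))"

text \<open>
  \<open>F\<close> is the map computed by the monDEQ with the given parameters. Strong monotonicity of
  \<open>mat 1 - W\<close> makes the fixed point \<open>z\<close> exist and be unique for every input \<open>x\<close>,
  so every admissible \<open>W\<close> has exactly one such \<open>F\<close>.
\<close>

definition monDEQ ::
  "real^'p^'p \<Rightarrow> real^'n^'p \<Rightarrow> real^'p \<Rightarrow> real^'p^'k \<Rightarrow> real^'k \<Rightarrow> (real^'n \<Rightarrow> real^'k) \<Rightarrow> bool" where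
  "monDEQ W U u C c F \<longleftrightarrow>
     (\<exists>m>0. \<forall>a. a \<bullet> ((mat 1 - W) *v a) \<ge> m * (norm a)\<^sup>2) \<and>
     (\<forall>x. \<exists>z. z = relu (W *v z + U *v x + u) \<and> F x = C *v z + c)"

section \<open>Positive semidefinite and Gram matrices\<close>

definition psd :: "real^'n^'n \<Rightarrow> bool" where
  "psd A \<longleftrightarrow> transpose A = A \<and> (\<forall>a. 0 \<le> a \<bullet> (A *v a))"

definition basis_vec :: "real^'n \<Rightarrow> real^'p \<Rightarrow> real^('n + 'p + unit)" where
  "basis_vec x z =
     (\<chi> i. case i of Inl j \<Rightarrow> x $ j | Inr (Inl j) \<Rightarrow> z $ j | Inr (Inr _) \<Rightarrow> 1)"

definition is_gram_matrix ::
  "(real^'n \<Rightarrow> real^'p \<Rightarrow> real) \<Rightarrow> real^('n + 'p + unit)^('n + 'p + unit) \<Rightarrow> bool" where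
  "is_gram_matrix f M \<longleftrightarrow>
     transpose M = M \<and> (\<forall>x z. f x z = basis_vec x z \<bullet> (M *v basis_vec x z))"

text \<open>Meaningful only if \<open>f\<close> is a polynomial of degree at most 2.\<close>

definition gram_matrix ::
  "(real^'n \<Rightarrow> real^'p \<Rightarrow> real) \<Rightarrow> real^('n + 'p + unit)^('n + 'p + unit)" where
  "gram_matrix f = (THE M. is_gram_matrix f M)"

section \<open>Real polynomials in several variables\<close>

text \<open>A monomial maps each variable to its exponent; a polynomial maps monomials to coefficients.\<close>

type_synonym 'v rpoly = "('v \<Rightarrow>\<^sub>0 nat) \<Rightarrow>\<^sub>0 real"

definition rpoly_eval :: "('v \<Rightarrow> real) \<Rightarrow> 'v rpoly \<Rightarrow> real" where
  "rpoly_eval s P =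
     (\<Sum>m\<in>Poly_Mapping.keys P.
        Poly_Mapping.lookup P m * (\<Prod>v\<in>Poly_Mapping.keys m. s v ^ Poly_Mapping.lookup m v))"

definition degree_le :: "nat \<Rightarrow> 'v rpoly \<Rightarrow> bool" where
  "degree_le d P \<longleftrightarrow>
     (\<forall>m\<in>Poly_Mapping.keys P. (\<Sum>v\<in>Poly_Mapping.keys m. Poly_Mapping.lookup m v) \<le> d)"

definition sum_of_squares :: "'v rpoly \<Rightarrow> bool" where
  "sum_of_squares P \<longleftrightarrow> (\<exists>qs. P = (\<Sum>q\<leftarrow>qs. q\<^sup>2))"

definition eval_at :: "real^'n \<Rightarrow> real^'p \<Rightarrow> ('n + 'p) rpoly \<Rightarrow> real" where
  "eval_at x z P = rpoly_eval (case_sum (($) x) (($) z)) P"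

section \<open>The two optimization problems\<close>

text \<open>
  The input constraint \<open>g\<close> takes values in \<open>real\<close> for \<open>q = 2\<close> and in \<open>real^'n\<close> for
  \<open>q = \<infinity>\<close>; the multiplier \<open>\<sigma>1\<close> has the same type. Both types are ordered Euclidean
  spaces, so \<open>0 \<le> \<sigma>1\<close> is coordinate-wise and \<open>\<sigma>1 \<bullet> g y\<close> is the product, respectively the
  scalar product. The product \<open>*\<close> of vectors is coordinate-wise.
\<close>

definition g_2 :: "real \<Rightarrow> real^'n \<Rightarrow> real" where
  "g_2 \<epsilon> y = \<epsilon>\<^sup>2 - (norm y)\<^sup>2"

definition g_inf :: "real \<Rightarrow> real^'n \<Rightarrow> real^'n" where
  "g_inf \<epsilon> y = (\<chi> i. \<epsilon>\<^sup>2 - (y $ i)\<^sup>2)"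

definition multiplier_terms ::
  "(real^'n \<Rightarrow> 's::ordered_euclidean_space) \<Rightarrow> real^'n \<Rightarrow>
   real^'p^'p \<Rightarrow> real^'n^'p \<Rightarrow> real^'p \<Rightarrow>
   's \<Rightarrow> real^'p \<Rightarrow> real^'p \<Rightarrow> real^'p \<Rightarrow> real^'n \<Rightarrow> real^'p \<Rightarrow> real" where
  "multiplier_terms g x0 W U u \<sigma>1 \<sigma>2 \<sigma>3 \<tau> x z =
     \<sigma>1 \<bullet> g (x - x0) + \<tau> \<bullet> (z * (z - W *v z - U *v x - u))
     + \<sigma>2 \<bullet> (z - W *v z - U *v x - u) + \<sigma>3 \<bullet> z"

text \<open>A maximization problem: its feasible set and its objective.\<close>

record ('t, 'v) max_problem =
  feasible :: "'t set"
  objective :: "'t \<Rightarrow> 'v"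

text \<open>Meant for nonnegative arguments.\<close>

definition ext_log :: "real \<Rightarrow> ereal" where
  "ext_log r = (if r = 0 then - \<infinity> else ereal (ln r))"

definition equivalent_via_log ::
  "('t, real) max_problem \<Rightarrow> ('t, ereal) max_problem \<Rightarrow> bool" where
  "equivalent_via_log P P' \<longleftrightarrow>
     feasible P = feasible P' \<and>
     (\<forall>t\<in>feasible P. 0 \<le> objective P t \<and> objective P' t = ext_log (objective P t))"

definition sos_problem ::
  "(real^'n \<Rightarrow> 's::ordered_euclidean_space) \<Rightarrow> real^'n \<Rightarrow>
   real^'p^'p \<Rightarrow> real^'n^'p \<Rightarrow> real^'p \<Rightarrow> real^'p^'k \<Rightarrow> real^'k \<Rightarrow>
   ((real^'k^'k) \<times> (real^'k) \<times> 's \<times> (real^'p) \<times> (real^'p) \<times> (real^'p), real) max_problem" where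
  "sos_problem g x0 W U u C c =
     \<lparr> feasible = {(Q, b, \<sigma>1, \<sigma>2, \<sigma>3, \<tau>).
         psd Q \<and> 0 \<le> \<sigma>1 \<and> 0 \<le> \<sigma>2 \<and> 0 \<le> \<sigma>3 \<and>
         (\<exists>\<sigma>0 :: ('n + 'p) rpoly. sum_of_squares \<sigma>0 \<and> degree_le 2 \<sigma>0 \<and>
            (\<forall>x z. 1 - (norm (Q *v (C *v z + c) + b))\<^sup>2 =
               eval_at x z \<sigma>0 + multiplier_terms g x0 W U u \<sigma>1 \<sigma>2 \<sigma>3 \<tau> x z))},
       objective = (\<lambda>(Q, b, \<sigma>1, \<sigma>2, \<sigma>3, \<tau>). det Q) \<rparr>"

definition sdp_problem ::
  "(real^'n \<Rightarrow> 's::ordered_euclidean_space) \<Rightarrow> real^'n \<Rightarrow>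
   real^'p^'p \<Rightarrow> real^'n^'p \<Rightarrow> real^'p \<Rightarrow> real^'p^'k \<Rightarrow> real^'k \<Rightarrow>
   ((real^'k^'k) \<times> (real^'k) \<times> 's \<times> (real^'p) \<times> (real^'p) \<times> (real^'p), ereal) max_problem" where
  "sdp_problem g x0 W U u C c =
     \<lparr> feasible = {(Q, b, \<sigma>1, \<sigma>2, \<sigma>3, \<tau>).
         psd Q \<and> 0 \<le> \<sigma>1 \<and> 0 \<le> \<sigma>2 \<and> 0 \<le> \<sigma>3 \<and>
         psd (- gram_matrix (\<lambda>x z. (norm (Q *v (C *v z + c) + b))\<^sup>2 - 1
                + multiplier_terms g x0 W U u \<sigma>1 \<sigma>2 \<sigma>3 \<tau> x z))},
       objective = (\<lambda>(Q, b, \<sigma>1, \<sigma>2, \<sigma>3, \<tau>). ext_log (det Q)) \<rparr>"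

end

theory Submission
  imports Defs
begin

text \<open>
  Both problems impose the same sign conditions and the same condition on \<open>Q\<close>, so the feasible
  sets agree once, for each fixed tuple, the polynomial identity is equivalent to the matrix
  inequality. The identity says that \<open>- f\<close> is a sum of squares of degree at most \<open>2\<close>, where \<open>f\<close> is
  the function whose Gram matrix \<open>M\<close> enters the semidefinite problem. This \<open>f\<close> is a sum of products
  of affine functions of \<open>(x, z)\<close>, so it has a Gram matrix, and it has only one. What remains is a
  fact about an arbitrary quadratic \<open>f\<close> (\<open>sos_representation_iff_psd\<close>):

  \<^item> A sum of squares is nonnegative at every \<open>(x, z)\<close>, so \<open>v \<bullet> (- M) v \<ge> 0\<close> for every vector
    \<open>v = (x, z, 1)\<close>. By homogeneity this extends to vectors with nonzero last coordinate, and by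
    continuity to all vectors (\<open>form_nonneg_if_nonneg_on_basis_vec\<close>).

  \<^item> A positive semidefinite form is a sum of squares of linear forms, by completing squares one
    variable at a time (\<open>psd_sum_of_squared_linear_forms\<close>). Evaluated at \<open>(x, z, 1)\<close>, the linear
    forms become affine polynomials, whose squares have degree at most \<open>2\<close>.

  The homogenization step also gives the uniqueness of the Gram matrix: the difference of two Gram
  matrices of \<open>f\<close> and its negative are both positive semidefinite, hence zero.

  The objectives correspond because the determinant of a positive semidefinite matrix is
  nonnegative (\<open>psd_det_nonneg\<close>).
\<close>

section \<open>Positive semidefinite matrices\<close>

lemma symmetric_inner_commute:
  fixes A :: "real^'n^'n"
  assumes "transpose A = A"
  shows "a \<bullet> (A *v b) = b \<bullet> (A *v a)"
  by (metis assms dot_lmul_matrix inner_commute transpose_matrix_vector)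

lemma axis_inner_matrix_axis:
  fixes A :: "real^'n^'n"
  shows "axis i 1 \<bullet> (A *v axis j 1) = A $ i $ j"
  by (simp add: matrix_vector_mult_basis column_def inner_axis')

lemma symmetric_form_add_scaleR:
  fixes A :: "real^'n^'n"
  assumes "transpose A = A"
  shows "(a + t *\<^sub>R e) \<bullet> (A *v (a + t *\<^sub>R e))
    = a \<bullet> (A *v a) + 2 * t * (a \<bullet> (A *v e)) + t\<^sup>2 * (e \<bullet> (A *v e))"
  using symmetric_inner_commute[OF assms, of e a]
  by (simp add: matrix_vector_right_distrib matrix_vector_mult_scaleR
      inner_add_left inner_add_right algebra_simps power2_eq_square)

definition outer :: "real^'n \<Rightarrow> real^'n \<Rightarrow> real^'n^'n" where
  "outer v w = (\<chi> i j. v $ i * w $ j)"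

lemma outer_mult_vec: "outer v w *v a = (w \<bullet> a) *\<^sub>R v"
  by (simp add: vec_eq_iff outer_def matrix_vector_mult_def inner_vec_def sum_distrib_left mult_ac)

lemma transpose_outer: "transpose (outer v w) = outer w v"
  by (simp add: vec_eq_iff outer_def transpose_def mult_ac)

lemma transpose_add: "transpose (A + B) = transpose A + transpose B"
  for A B :: "real^'n^'m"
  by (simp add: vec_eq_iff transpose_def)

lemma transpose_diff: "transpose (A - B) = transpose A - transpose B"
  for A B :: "real^'n^'m"
  by (simp add: vec_eq_iff transpose_def)

lemma transpose_uminus: "transpose (- A) = - transpose A"
  for A :: "real^'n^'m"
  by (simp add: vec_eq_iff transpose_def)

lemma uminus_matrix_vector_mult: "(- A) *v a = - (A *v a)"
  for A :: "real^'n^'m"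
  using matrix_vector_mult_diff_rdistrib[of 0 A a] by simp

lemma psd_diagonal_nonneg:
  assumes "psd A"
  shows "0 \<le> A $ i $ i"
  using assms axis_inner_matrix_axis[of i A i] unfolding psd_def by metis

text \<open>
  On the vectors \<open>e\<^sub>i + t e\<^sub>j\<close> the form takes the value \<open>2 t A\<^sub>i\<^sub>j\<close>, which is nonnegative for both
  signs of \<open>t\<close> only if \<open>A\<^sub>i\<^sub>j = 0\<close>.
\<close>

lemma psd_zero_diagonal:
  assumes A: "psd A" and diag: "\<And>i. A $ i $ i = 0"
  shows "A = 0"
proof -
  have "A $ i $ j = 0" for i j
  proof -
    have sym: "transpose A = A" using A by (simp add: psd_def)
    have "0 \<le> 2 * t * A $ i $ j" for t
    proof -
      have "0 \<le> (axis i 1 + t *\<^sub>R axis j 1) \<bullet> (A *v (axis i 1 + t *\<^sub>R axis j 1))"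
        using A by (simp add: psd_def)
      then show ?thesis
        by (simp only: symmetric_form_add_scaleR[OF sym] axis_inner_matrix_axis diag)
    qed
    from this[of 1] this[of "-1"] show ?thesis by simp
  qed
  then show ?thesis by (simp add: vec_eq_iff)
qed

text \<open>
  Completing the square in the \<open>i\<close>-th variable. With \<open>r\<close> the \<open>i\<close>-th column, the reduced form is
  \<open>a \<bullet> A a - (r \<bullet> a)\<^sup>2 / A\<^sub>i\<^sub>i\<close>, the minimum over \<open>t\<close> of the original form at \<open>a + t e\<^sub>i\<close>. It is
  therefore again positive semidefinite, which also prevents a diagonal entry that is already
  zero from becoming nonzero, since it can only decrease.
\<close>

lemma psd_eliminate:
  assumes A: "psd A" and pos: "A $ i $ i \<noteq> 0"
  defines "r \<equiv> A *v axis i 1"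
  shows "psd (A - (1 / A $ i $ i) *\<^sub>R outer r r)" (is "psd ?B")
    and "(A - (1 / A $ i $ i) *\<^sub>R outer r r) $ i $ i = 0"
    and "A $ j $ j = 0 \<Longrightarrow> (A - (1 / A $ i $ i) *\<^sub>R outer r r) $ j $ j = 0"
    and "a \<bullet> (A *v a)
      = a \<bullet> ((A - (1 / A $ i $ i) *\<^sub>R outer r r) *v a) + (r \<bullet> a)\<^sup>2 / A $ i $ i"
proof -
  let ?d = "A $ i $ i"
  have sym: "transpose A = A" using A by (simp add: psd_def)
  have d: "?d > 0" using pos psd_diagonal_nonneg[OF A, of i] by simp
  have form: "a \<bullet> (?B *v a) = a \<bullet> (A *v a) - (r \<bullet> a)\<^sup>2 / ?d" for a
    by (simp add: matrix_vector_mult_diff_rdistrib scaleR_matrix_vector_assoc[symmetric]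
        outer_mult_vec inner_diff_right power2_eq_square inner_commute)
  then show "a \<bullet> (A *v a) = a \<bullet> (?B *v a) + (r \<bullet> a)\<^sup>2 / ?d"
    by simp
  have "0 \<le> a \<bullet> (?B *v a)" for a
  proof -
    (* the minimizer of the form along the line a + t e_i *)
    let ?t = "- (r \<bullet> a) / ?d"
    have "0 \<le> (a + ?t *\<^sub>R axis i 1) \<bullet> (A *v (a + ?t *\<^sub>R axis i 1))"
      using A by (simp only: psd_def)
    also have "\<dots> = a \<bullet> (A *v a) + 2 * ?t * (r \<bullet> a) + ?t\<^sup>2 * ?d"
      unfolding symmetric_form_add_scaleR[OF sym] axis_inner_matrix_axis
      by (simp add: r_def inner_commute)
    also have "\<dots> = a \<bullet> (?B *v a)"
      using d unfolding form by (simp add: field_simps power2_eq_square)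
    finally show ?thesis .
  qed
  then show psdB: "psd ?B"
    by (simp add: psd_def transpose_diff transpose_scalar transpose_outer sym)
  have diag: "?B $ j $ j = A $ j $ j - (A $ j $ i)\<^sup>2 / ?d" for j
    by (simp add: outer_def r_def matrix_vector_mult_basis column_def power2_eq_square)
  show "?B $ i $ i = 0"
    unfolding diag using d by (simp add: power2_eq_square)
  show "?B $ j $ j = 0" if "A $ j $ j = 0"
  proof -
    have "0 \<le> (A $ j $ i)\<^sup>2 / ?d" using d by simp
    then show ?thesis
      using psd_diagonal_nonneg[OF psdB, of j] diag[of j] that by linarith
  qed
qed

text \<open>
  Each elimination step splits off one squared linear form and lowers the number of nonzero
  diagonal entries; when none is left, the matrix is zero.
\<close>

lemma psd_sum_of_squared_linear_forms:
  assumes "psd A"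
  shows "\<exists>ws. \<forall>a. a \<bullet> (A *v a) = (\<Sum>w\<leftarrow>ws. (w \<bullet> a)\<^sup>2)"
  using assms
proof (induction "card {i. A $ i $ i \<noteq> 0}" arbitrary: A rule: less_induct)
  case less
  show ?case
  proof (cases "\<forall>i. A $ i $ i = 0")
    case True
    then have "A = 0" using psd_zero_diagonal less.prems by blast
    then show ?thesis by (intro exI[of _ "[]"]) simp
  next
    case False
    then obtain i where i: "A $ i $ i \<noteq> 0" by blast
    define r where "r = A *v axis i 1"
    define B where "B = A - (1 / A $ i $ i) *\<^sub>R outer r r"
    note elim = psd_eliminate[OF less.prems i, folded r_def, folded B_def]
    have "{j. B $ j $ j \<noteq> 0} \<subset> {j. A $ j $ j \<noteq> 0}"
      using elim(2,3) i by blast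
    then have "card {j. B $ j $ j \<noteq> 0} < card {j. A $ j $ j \<noteq> 0}"
      by (simp add: psubset_card_mono)
    from less.hyps[OF this elim(1)] obtain ws
      where ws: "\<And>a. a \<bullet> (B *v a) = (\<Sum>w\<leftarrow>ws. (w \<bullet> a)\<^sup>2)" by blast
    have "0 < A $ i $ i" using i psd_diagonal_nonneg[OF less.prems, of i] by simp
    then have "(((1 / sqrt (A $ i $ i)) *\<^sub>R r) \<bullet> a)\<^sup>2 = (r \<bullet> a)\<^sup>2 / A $ i $ i" for a
      by (simp add: power_divide)
    then show ?thesis
      using elim(4) ws by (intro exI[of _ "((1 / sqrt (A $ i $ i)) *\<^sub>R r) # ws"]) simp
  qed
qed

text \<open>
  On the segment from \<open>Q\<close> to the identity every matrix other than \<open>Q\<close> is positive definite, hence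
  invertible. The determinant is \<open>1\<close> at the identity and has no zero before \<open>Q\<close>, so it cannot be
  negative at \<open>Q\<close>.
\<close>

lemma psd_det_nonneg:
  fixes Q :: "real^'k^'k"
  assumes "psd Q"
  shows "0 \<le> det Q"
proof (rule ccontr)
  let ?A = "\<lambda>t. (1 - t) *\<^sub>R Q + t *\<^sub>R (mat 1 :: real^'k^'k)"
  assume "\<not> 0 \<le> det Q"
  then have "det (?A 0) \<le> 0" and "0 \<le> det (?A 1)" by simp_all
  moreover have "continuous_on {0..1} (\<lambda>t. det (?A t))"
    unfolding det_def by (intro continuous_intros)
  ultimately obtain t where t: "0 \<le> t" "t \<le> 1" "det (?A t) = 0"
    using IVT'[of "\<lambda>t. det (?A t)" 0 0 1] by auto
  with \<open>\<not> 0 \<le> det Q\<close> have "0 < t" by (cases "t = 0") auto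
  have "a = 0" if "?A t *v a = 0" for a
  proof -
    have "0 = a \<bullet> (?A t *v a)" using that by simp
    also have "\<dots> = (1 - t) * (a \<bullet> (Q *v a)) + t * (a \<bullet> a)"
      by (simp add: matrix_vector_mult_add_rdistrib scaleR_matrix_vector_assoc[symmetric]
          inner_add_right)
    finally have "(1 - t) * (a \<bullet> (Q *v a)) + t * (a \<bullet> a) = 0" ..
    moreover have "0 \<le> (1 - t) * (a \<bullet> (Q *v a))"
      using t assms by (simp add: psd_def)
    moreover have "0 \<le> t * (a \<bullet> a)" using \<open>0 < t\<close> by simp
    ultimately have "t * (a \<bullet> a) = 0" by linarith
    with \<open>0 < t\<close> show "a = 0" by simp
  qed
  then have "invertible (?A t)"
    unfolding invertible_left_inverse matrix_left_invertible_ker by blast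
  with t(3) show False by (simp add: invertible_det_nz)
qed

section \<open>Gram matrices\<close>

lemma basis_vec_nth [simp]:
  "basis_vec x z $ Inl i = x $ i"
  "basis_vec x z $ Inr (Inl j) = z $ j"
  "basis_vec x z $ Inr (Inr l) = 1"
  by (simp_all add: basis_vec_def)

text \<open>
  A vector with last coordinate \<open>t \<noteq> 0\<close> is \<open>t\<close> times a vector \<open>(x, z, 1)\<close>, and the form scales by
  \<open>t\<^sup>2\<close>. A vector with last coordinate \<open>0\<close> is the limit of vectors of the first kind.
\<close>

lemma form_nonneg_if_nonneg_on_basis_vec:
  fixes M :: "real^('n::finite + 'p::finite + unit)^('n + 'p + unit)"
  assumes sym: "transpose M = M"
    and nonneg: "\<And>x z. 0 \<le> basis_vec x z \<bullet> (M *v basis_vec x z)"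
  shows "0 \<le> y \<bullet> (M *v y)"
proof -
  let ?l = "Inr (Inr ()) :: 'n + 'p + unit"
  have main: "0 \<le> y \<bullet> (M *v y)" if "y $ ?l \<noteq> 0" for y
  proof -
    let ?t = "y $ ?l"
    define x :: "real^'n" where "x = (\<chi> i. y $ Inl i / ?t)"
    define z :: "real^'p" where "z = (\<chi> i. y $ Inr (Inl i) / ?t)"
    have y: "y = ?t *\<^sub>R basis_vec x z"
      unfolding vec_eq_iff using that
      by (auto simp: x_def z_def basis_vec_def split: sum.split)
    have "y \<bullet> (M *v y) = (?t *\<^sub>R basis_vec x z) \<bullet> (M *v (?t *\<^sub>R basis_vec x z))"
      using y by (rule arg_cong)
    also have "\<dots> = ?t\<^sup>2 * (basis_vec x z \<bullet> (M *v basis_vec x z))"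
      by (simp add: matrix_vector_mult_scaleR power2_eq_square)
    finally show ?thesis using nonneg by simp
  qed
  show ?thesis
  proof (cases "y $ ?l = 0")
    case True
    (* perturb the last coordinate of y by s and let s tend to 0; h is the form at y + s e *)
    let ?e = "axis ?l 1 :: real^('n + 'p + unit)"
    let ?h = "\<lambda>s. y \<bullet> (M *v y) + 2 * s * (y \<bullet> (M *v ?e)) + s\<^sup>2 * (?e \<bullet> (M *v ?e))"
    have "(?h \<longlongrightarrow> y \<bullet> (M *v y) + 2 * 0 * (y \<bullet> (M *v ?e)) + 0\<^sup>2 * (?e \<bullet> (M *v ?e))) (at 0)"
      by (intro tendsto_intros)
    moreover have "0 \<le> ?h s" if "s \<noteq> 0" for s
      using main[of "y + s *\<^sub>R ?e"] that True symmetric_form_add_scaleR[OF sym, of y s ?e]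
      by simp
    then have "eventually (\<lambda>s. 0 \<le> ?h s) (at 0)"
      by (simp add: eventually_at_filter)
    ultimately show ?thesis
      using tendsto_lowerbound[of ?h _ "at 0" 0] by simp
  qed (rule main)
qed

lemma psd_iff_nonneg_on_basis_vec:
  fixes M :: "real^('n::finite + 'p::finite + unit)^('n + 'p + unit)"
  assumes "transpose M = M"
  shows "psd M \<longleftrightarrow> (\<forall>x z. 0 \<le> basis_vec x z \<bullet> (M *v basis_vec x z))"
  using assms form_nonneg_if_nonneg_on_basis_vec[OF assms] unfolding psd_def by blast

text \<open>
  The form of the difference \<open>D\<close> vanishes on all \<open>(x, z, 1)\<close>, so \<open>D\<close> and \<open>- D\<close> are both positive
  semidefinite. Then the diagonal of \<open>D\<close> is zero, and with it all of \<open>D\<close>.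
\<close>

lemma gram_matrix_unique:
  fixes M N :: "real^('n::finite + 'p::finite + unit)^('n + 'p + unit)"
  assumes "is_gram_matrix f M" and "is_gram_matrix f N"
  shows "M = N"
proof -
  let ?D = "M - N"
  have sym: "transpose ?D = ?D" and sym': "transpose (- ?D) = - ?D"
    using assms by (simp_all add: is_gram_matrix_def transpose_diff transpose_uminus)
  have zero: "basis_vec x z \<bullet> (?D *v basis_vec x z) = 0" for x z
    using assms
    by (simp add: is_gram_matrix_def matrix_vector_mult_diff_rdistrib inner_diff_right)
  have psd: "psd ?D" and psd': "psd (- ?D)"
    unfolding psd_iff_nonneg_on_basis_vec[OF sym] psd_iff_nonneg_on_basis_vec[OF sym']
    by (simp_all only: uminus_matrix_vector_mult inner_minus_right zero) simp_all
  have "?D $ i $ i = 0" for i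
    using psd_diagonal_nonneg[OF psd, of i] psd_diagonal_nonneg[OF psd', of i] by simp
  then have "?D = 0" by (rule psd_zero_diagonal[OF psd])
  then show ?thesis by simp
qed

lemma gram_matrix_eqI: "is_gram_matrix f M \<Longrightarrow> gram_matrix f = M"
  unfolding gram_matrix_def using gram_matrix_unique by blast

section \<open>Functions with a Gram matrix\<close>

text \<open>
  Closure properties of these two classes yield a Gram matrix for the function in the
  semidefinite problem without writing that matrix down.
\<close>

definition affine_fun :: "(real^'n \<Rightarrow> real^'p \<Rightarrow> real) \<Rightarrow> bool" where
  "affine_fun l \<longleftrightarrow> (\<exists>w. \<forall>x z. l x z = w \<bullet> basis_vec x z)"

definition quadratic_fun :: "(real^'n \<Rightarrow> real^'p \<Rightarrow> real) \<Rightarrow> bool" where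
  "quadratic_fun f \<longleftrightarrow> (\<exists>M. is_gram_matrix f M)"

lemma affine_fun_x: "affine_fun (\<lambda>x z. x $ i)"
  unfolding affine_fun_def by (intro exI[of _ "axis (Inl i) 1"]) (simp add: inner_axis')

lemma affine_fun_z: "affine_fun (\<lambda>x z. z $ i)"
  unfolding affine_fun_def by (intro exI[of _ "axis (Inr (Inl i)) 1"]) (simp add: inner_axis')

lemma affine_fun_const: "affine_fun (\<lambda>x z. a)"
  unfolding affine_fun_def by (intro exI[of _ "axis (Inr (Inr ())) a"]) (simp add: inner_axis')

lemma affine_fun_add:
  "affine_fun l \<Longrightarrow> affine_fun l' \<Longrightarrow> affine_fun (\<lambda>x z. l x z + l' x z)"
  unfolding affine_fun_def by (metis inner_add_left)

lemma affine_fun_diff: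
  "affine_fun l \<Longrightarrow> affine_fun l' \<Longrightarrow> affine_fun (\<lambda>x z. l x z - l' x z)"
  unfolding affine_fun_def by (metis inner_diff_left)

lemma affine_fun_cmult: "affine_fun l \<Longrightarrow> affine_fun (\<lambda>x z. a * l x z)"
  unfolding affine_fun_def by (metis inner_scaleR_left)

lemma affine_fun_sum:
  "(\<And>i. affine_fun (l i)) \<Longrightarrow> affine_fun (\<lambda>x z. \<Sum>i\<in>I. l i x z)"
  by (induction I rule: infinite_finite_induct) (simp_all add: affine_fun_const affine_fun_add)

text \<open>
  If \<open>w\<close> and \<open>w'\<close> are the coefficient vectors of the factors, the product is the quadratic form of
  \<open>w w'\<^sup>T\<close>; its symmetric part has the same form.
\<close>

lemma quadratic_fun_mult:
  assumes "affine_fun l" and "affine_fun l'"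
  shows "quadratic_fun (\<lambda>x z. l x z * l' x z)"
proof -
  obtain w w' where "\<And>x z. l x z = w \<bullet> basis_vec x z" "\<And>x z. l' x z = w' \<bullet> basis_vec x z"
    using assms unfolding affine_fun_def by blast
  then have "is_gram_matrix (\<lambda>x z. l x z * l' x z) ((1/2) *\<^sub>R (outer w w' + outer w' w))"
    by (simp add: is_gram_matrix_def transpose_scalar transpose_add transpose_outer add.commute
        scaleR_matrix_vector_assoc[symmetric] matrix_vector_mult_add_rdistrib outer_mult_vec
        inner_add_right inner_commute)
  then show ?thesis unfolding quadratic_fun_def by blast
qed

lemma quadratic_fun_add:
  assumes "quadratic_fun f" and "quadratic_fun g"
  shows "quadratic_fun (\<lambda>x z. f x z + g x z)"
proof -
  obtain M N where "is_gram_matrix f M" "is_gram_matrix g N"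
    using assms unfolding quadratic_fun_def by blast
  then have "is_gram_matrix (\<lambda>x z. f x z + g x z) (M + N)"
    by (simp add: is_gram_matrix_def transpose_add matrix_vector_mult_add_rdistrib inner_add_right)
  then show ?thesis unfolding quadratic_fun_def by blast
qed

lemma quadratic_fun_affine: "affine_fun l \<Longrightarrow> quadratic_fun l"
  using quadratic_fun_mult[OF _ affine_fun_const, of l 1] by simp

lemma quadratic_fun_cmult:
  assumes "quadratic_fun f"
  shows "quadratic_fun (\<lambda>x z. a * f x z)"
proof -
  obtain M where "is_gram_matrix f M"
    using assms unfolding quadratic_fun_def by blast
  then have "is_gram_matrix (\<lambda>x z. a * f x z) (a *\<^sub>R M)"
    by (simp add: is_gram_matrix_def transpose_scalar scaleR_matrix_vector_assoc[symmetric])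
  then show ?thesis unfolding quadratic_fun_def by blast
qed

lemma quadratic_fun_diff:
  assumes "quadratic_fun f" and "quadratic_fun g"
  shows "quadratic_fun (\<lambda>x z. f x z - g x z)"
  using quadratic_fun_add[OF assms(1) quadratic_fun_cmult[OF assms(2), of "-1"]] by simp

lemma quadratic_fun_sum:
  "(\<And>i. quadratic_fun (f i)) \<Longrightarrow> quadratic_fun (\<lambda>x z. \<Sum>i\<in>I. f i x z)"
  by (induction I rule: infinite_finite_induct)
    (simp_all add: quadratic_fun_add quadratic_fun_affine[OF affine_fun_const])

lemmas affine_fun_intros =
  affine_fun_x affine_fun_z affine_fun_const affine_fun_add affine_fun_diff
  affine_fun_cmult affine_fun_sum

lemma quadratic_fun_norm_sq:
  fixes y :: "real^'n \<Rightarrow> real^'p \<Rightarrow> real^'k"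
  assumes "\<And>i. affine_fun (\<lambda>x z. y x z $ i)"
  shows "quadratic_fun (\<lambda>x z. (norm (y x z))\<^sup>2)"
  unfolding power2_norm_eq_inner inner_vec_def inner_real_def
  by (intro quadratic_fun_sum quadratic_fun_mult assms)

lemma affine_fun_residual:
  "affine_fun (\<lambda>x z. (z - W *v z - U *v x - u) $ i)"
  by (simp add: matrix_vector_mult_def) (intro affine_fun_intros)

lemma quadratic_fun_multiplier_terms:
  assumes "quadratic_fun (\<lambda>x (z :: real^'p). \<sigma>1 \<bullet> g (x - x0))"
  shows "quadratic_fun (multiplier_terms g x0 W U u \<sigma>1 \<sigma>2 \<sigma>3 (\<tau> :: real^'p))"
proof -
  have "quadratic_fun (\<lambda>x z. \<tau> \<bullet> (z * (z - W *v z - U *v x - u)))"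
    unfolding inner_vec_def inner_real_def vector_mult_component
    by (intro quadratic_fun_sum quadratic_fun_cmult quadratic_fun_mult affine_fun_z
        affine_fun_residual)
  moreover have "quadratic_fun (\<lambda>x z. \<sigma>2 \<bullet> (z - W *v z - U *v x - u))"
    unfolding inner_vec_def inner_real_def
    by (intro quadratic_fun_sum quadratic_fun_cmult quadratic_fun_affine affine_fun_residual)
  moreover have "quadratic_fun (\<lambda>(x :: real^'a) z. \<sigma>3 \<bullet> z)"
    unfolding inner_vec_def inner_real_def
    by (intro quadratic_fun_sum quadratic_fun_cmult quadratic_fun_affine affine_fun_z)
  ultimately show ?thesis
    unfolding multiplier_terms_def[abs_def] by (intro quadratic_fun_add assms)
qed

lemma quadratic_fun_g_2:
  "quadratic_fun (\<lambda>x (z :: real^'p). \<sigma> \<bullet> g_2 \<epsilon> (x - x0))"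
  unfolding g_2_def inner_real_def
  by (intro quadratic_fun_cmult quadratic_fun_diff quadratic_fun_norm_sq
      quadratic_fun_affine[OF affine_fun_const])
    (simp, intro affine_fun_intros)

lemma quadratic_fun_g_inf:
  "quadratic_fun (\<lambda>x (z :: real^'p). \<sigma> \<bullet> g_inf \<epsilon> (x - x0))"
  unfolding g_inf_def inner_vec_def inner_real_def power2_eq_square
  by (simp, intro quadratic_fun_sum quadratic_fun_cmult quadratic_fun_diff quadratic_fun_mult
      quadratic_fun_affine[OF affine_fun_const] affine_fun_intros)

section \<open>Evaluation and degree of polynomials\<close>

definition monom_eval :: "('v \<Rightarrow> real) \<Rightarrow> ('v \<Rightarrow>\<^sub>0 nat) \<Rightarrow> real" where
  "monom_eval s m = (\<Prod>v\<in>Poly_Mapping.keys m. s v ^ Poly_Mapping.lookup m v)"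

definition monom_degree :: "('v \<Rightarrow>\<^sub>0 nat) \<Rightarrow> nat" where
  "monom_degree m = (\<Sum>v\<in>Poly_Mapping.keys m. Poly_Mapping.lookup m v)"

lemma monom_eval_superset:
  assumes "finite S" and "Poly_Mapping.keys m \<subseteq> S"
  shows "monom_eval s m = (\<Prod>v\<in>S. s v ^ Poly_Mapping.lookup m v)"
  unfolding monom_eval_def using assms
  by (intro prod.mono_neutral_left) (auto simp: in_keys_iff)

lemma monom_degree_superset:
  assumes "finite S" and "Poly_Mapping.keys m \<subseteq> S"
  shows "monom_degree m = (\<Sum>v\<in>S. Poly_Mapping.lookup m v)"
  unfolding monom_degree_def using assms
  by (intro sum.mono_neutral_left) (auto simp: in_keys_iff)

text \<open>
  Two monomials, or two polynomials, have different supports in general. Sums and products over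
  their keys are compared by extending them to the union of the supports.
\<close>

lemma monom_eval_add: "monom_eval s (m + n) = monom_eval s m * monom_eval s n"
proof -
  let ?S = "Poly_Mapping.keys m \<union> Poly_Mapping.keys n"
  have "Poly_Mapping.keys (m + n) \<subseteq> ?S" by (rule keys_add)
  then show ?thesis
    by (simp add: monom_eval_superset[of ?S] lookup_add power_add prod.distrib)
qed

lemma monom_degree_add: "monom_degree (m + n) = monom_degree m + monom_degree n"
proof -
  let ?S = "Poly_Mapping.keys m \<union> Poly_Mapping.keys n"
  have "Poly_Mapping.keys (m + n) \<subseteq> ?S" by (rule keys_add)
  then show ?thesis
    by (simp add: monom_degree_superset[of ?S] lookup_add sum.distrib)
qed

lemma rpoly_eval_superset:
  assumes "finite S" and "Poly_Mapping.keys P \<subseteq> S"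
  shows "rpoly_eval s P = (\<Sum>m\<in>S. Poly_Mapping.lookup P m * monom_eval s m)"
  unfolding rpoly_eval_def monom_eval_def using assms
  by (intro sum.mono_neutral_left) (auto simp: in_keys_iff)

lemma rpoly_eval_0 [simp]: "rpoly_eval s 0 = 0"
  by (simp add: rpoly_eval_def)

lemma rpoly_eval_add: "rpoly_eval s (P + Q) = rpoly_eval s P + rpoly_eval s Q"
proof -
  let ?S = "Poly_Mapping.keys P \<union> Poly_Mapping.keys Q"
  have "Poly_Mapping.keys (P + Q) \<subseteq> ?S" by (rule keys_add)
  then show ?thesis
    by (simp add: rpoly_eval_superset[of ?S] lookup_add sum.distrib distrib_right)
qed

lemma rpoly_eval_sum: "rpoly_eval s (\<Sum>i\<in>I. P i) = (\<Sum>i\<in>I. rpoly_eval s (P i))"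
  by (induction I rule: infinite_finite_induct) (simp_all add: rpoly_eval_add)

lemma rpoly_eval_sum_list: "rpoly_eval s (\<Sum>i\<leftarrow>is. P i) = (\<Sum>i\<leftarrow>is. rpoly_eval s (P i))"
  by (induction "is") (simp_all add: rpoly_eval_add)

lemma rpoly_eval_single: "rpoly_eval s (Poly_Mapping.single m a) = a * monom_eval s m"
  using rpoly_eval_superset[of "{m}" "Poly_Mapping.single m a" s] by simp

lemma rpoly_eq_sum_single:
  fixes P :: "'v rpoly"
  shows "P = (\<Sum>m\<in>Poly_Mapping.keys P. Poly_Mapping.single m (Poly_Mapping.lookup P m))"
proof (rule poly_mapping_eqI)
  fix k
  show "Poly_Mapping.lookup P k =
    Poly_Mapping.lookup (\<Sum>m\<in>Poly_Mapping.keys P. Poly_Mapping.single m (Poly_Mapping.lookup P m)) k"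
    by (simp add: lookup_sum lookup_single when_def sum.delta in_keys_iff)
qed

lemma rpoly_eval_mult: "rpoly_eval s (P * Q) = rpoly_eval s P * rpoly_eval s Q"
proof -
  let ?KP = "Poly_Mapping.keys P" and ?KQ = "Poly_Mapping.keys Q"
  define p where "p m = Poly_Mapping.single m (Poly_Mapping.lookup P m)" for m
  define q where "q m = Poly_Mapping.single m (Poly_Mapping.lookup Q m)" for m
  have P: "P = (\<Sum>m\<in>?KP. p m)" and Q: "Q = (\<Sum>m\<in>?KQ. q m)"
    unfolding p_def q_def by (rule rpoly_eq_sum_single)+
  have pq: "rpoly_eval s (p m * q n) = rpoly_eval s (p m) * rpoly_eval s (q n)" for m n
    by (simp add: p_def q_def mult_single rpoly_eval_single monom_eval_add)
  have "P * Q = (\<Sum>m\<in>?KP. p m) * (\<Sum>n\<in>?KQ. q n)"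
    by (rule arg_cong2[OF P Q])
  also have "\<dots> = (\<Sum>m\<in>?KP. \<Sum>n\<in>?KQ. p m * q n)"
    by (rule sum_product)
  finally have "rpoly_eval s (P * Q) = (\<Sum>m\<in>?KP. \<Sum>n\<in>?KQ. rpoly_eval s (p m) * rpoly_eval s (q n))"
    by (simp only: rpoly_eval_sum pq)
  also have "\<dots> = rpoly_eval s (\<Sum>m\<in>?KP. p m) * rpoly_eval s (\<Sum>m\<in>?KQ. q m)"
    by (simp only: rpoly_eval_sum sum_product)
  also have "\<dots> = rpoly_eval s P * rpoly_eval s Q"
    by (simp only: P[symmetric] Q[symmetric])
  finally show ?thesis .
qed

lemma degree_le_iff: "degree_le d P \<longleftrightarrow> (\<forall>m\<in>Poly_Mapping.keys P. monom_degree m \<le> d)"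
  by (simp add: degree_le_def monom_degree_def)

lemma degree_le_0 [simp]: "degree_le d 0"
  by (simp add: degree_le_def)

lemma degree_le_add: "degree_le d P \<Longrightarrow> degree_le d Q \<Longrightarrow> degree_le d (P + Q)"
  using keys_add[of P Q] unfolding degree_le_def by blast

lemma degree_le_sum: "(\<And>i. i \<in> I \<Longrightarrow> degree_le d (P i)) \<Longrightarrow> degree_le d (\<Sum>i\<in>I. P i)"
  by (induction I rule: infinite_finite_induct) (simp_all add: degree_le_add)

lemma degree_le_sum_list:
  "(\<And>i. i \<in> set is \<Longrightarrow> degree_le d (P i)) \<Longrightarrow> degree_le d (\<Sum>i\<leftarrow>is. P i)"
  by (induction "is") (simp_all add: degree_le_add)

lemma degree_le_single: "monom_degree m \<le> d \<Longrightarrow> degree_le d (Poly_Mapping.single m a)"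
  by (simp add: degree_le_iff)

lemma degree_le_mult:
  assumes "degree_le d P" and "degree_le e Q"
  shows "degree_le (d + e) (P * Q)"
  unfolding degree_le_iff
proof
  fix m
  assume "m \<in> Poly_Mapping.keys (P * Q)"
  then obtain a b where "m = a + b" "a \<in> Poly_Mapping.keys P" "b \<in> Poly_Mapping.keys Q"
    using keys_mult[of P Q] by auto
  then show "monom_degree m \<le> d + e"
    using assms by (simp add: degree_le_iff monom_degree_add add_mono)
qed

lemma sum_of_squares_eval_nonneg:
  assumes "sum_of_squares P"
  shows "0 \<le> rpoly_eval s P"
proof -
  obtain qs where "P = (\<Sum>q\<leftarrow>qs. q\<^sup>2)" using assms unfolding sum_of_squares_def by blast
  then have "rpoly_eval s P = (\<Sum>q\<leftarrow>qs. (rpoly_eval s q)\<^sup>2)"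
    by (simp add: rpoly_eval_sum_list power2_eq_square rpoly_eval_mult)
  then show ?thesis by (auto intro!: sum_list_nonneg)
qed

text \<open>
  The polynomial that represents the function \<open>w \<bullet> (x, z, 1)\<close>.
\<close>

definition affine_rpoly :: "real^('n::finite + 'p::finite + unit) \<Rightarrow> ('n + 'p) rpoly" where
  "affine_rpoly w =
     (\<Sum>i\<in>UNIV. Poly_Mapping.single (Poly_Mapping.single (Inl i) 1) (w $ Inl i))
     + (\<Sum>i\<in>UNIV. Poly_Mapping.single (Poly_Mapping.single (Inr i) 1) (w $ Inr (Inl i)))
     + Poly_Mapping.single 0 (w $ Inr (Inr ()))"

lemma eval_at_affine_rpoly: "eval_at x z (affine_rpoly w) = w \<bullet> basis_vec x z"
proof -
  have "w \<bullet> basis_vec x z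
    = (\<Sum>i\<in>UNIV. w $ Inl i * x $ i) + (\<Sum>i\<in>UNIV. w $ Inr (Inl i) * z $ i) + w $ Inr (Inr ())"
    unfolding inner_vec_def UNIV_Plus_UNIV[symmetric]
    by (simp add: sum.Plus UNIV_unit del: UNIV_Plus_UNIV)
  then show ?thesis
    by (simp add: eval_at_def affine_rpoly_def rpoly_eval_add rpoly_eval_sum rpoly_eval_single
        monom_eval_def)
qed

lemma degree_le_affine_rpoly: "degree_le 1 (affine_rpoly w)"
  unfolding affine_rpoly_def
  by (intro degree_le_add degree_le_sum degree_le_single) (simp_all add: monom_degree_def)

section \<open>Equivalence of the two problems\<close>

text \<open>
  Both sides amount to \<open>- f\<close> being nonnegative everywhere: a quadratic function that is nonnegative
  everywhere has a positive semidefinite Gram matrix, which splits into squares of linear forms.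
\<close>

lemma sos_representation_iff_psd:
  fixes f :: "real^'n \<Rightarrow> real^'p \<Rightarrow> real"
  assumes "quadratic_fun f"
  shows "(\<exists>\<sigma> :: ('n + 'p) rpoly. sum_of_squares \<sigma> \<and> degree_le 2 \<sigma> \<and>
            (\<forall>x z. - f x z = eval_at x z \<sigma>))
    \<longleftrightarrow> psd (- gram_matrix f)"
proof -
  obtain M where M: "is_gram_matrix f M" using assms unfolding quadratic_fun_def by blast
  then have gram: "gram_matrix f = M" by (rule gram_matrix_eqI)
  have form: "- f x z = basis_vec x z \<bullet> ((- M) *v basis_vec x z)" for x z
    using M by (simp add: is_gram_matrix_def uminus_matrix_vector_mult)
  have sym: "transpose (- M) = - M"
    using M by (simp add: is_gram_matrix_def transpose_uminus)
  show ?thesis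
    unfolding gram
  proof
    assume "\<exists>\<sigma> :: ('n + 'p) rpoly. sum_of_squares \<sigma> \<and> degree_le 2 \<sigma> \<and>
      (\<forall>x z. - f x z = eval_at x z \<sigma>)"
    then have "0 \<le> - f x z" for x z
      by (metis eval_at_def sum_of_squares_eval_nonneg)
    then show "psd (- M)"
      unfolding psd_iff_nonneg_on_basis_vec[OF sym] form by blast
  next
    assume "psd (- M)"
    then obtain ws where ws: "\<And>a. a \<bullet> ((- M) *v a) = (\<Sum>w\<leftarrow>ws. (w \<bullet> a)\<^sup>2)"
      using psd_sum_of_squared_linear_forms by blast
    define \<sigma> :: "('n + 'p) rpoly" where "\<sigma> = (\<Sum>w\<leftarrow>ws. (affine_rpoly w)\<^sup>2)"
    have "sum_of_squares \<sigma>"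
      unfolding sum_of_squares_def \<sigma>_def
      by (intro exI[of _ "map affine_rpoly ws"]) (simp add: comp_def)
    moreover have "degree_le 2 \<sigma>"
      unfolding \<sigma>_def power2_eq_square
      using degree_le_mult[OF degree_le_affine_rpoly degree_le_affine_rpoly]
      by (intro degree_le_sum_list) (simp add: numeral_2_eq_2)
    moreover have "- f x z = eval_at x z \<sigma>" for x z
    proof -
      have "eval_at x z \<sigma> = (\<Sum>w\<leftarrow>ws. (eval_at x z (affine_rpoly w))\<^sup>2)"
        by (simp add: \<sigma>_def eval_at_def rpoly_eval_sum_list power2_eq_square rpoly_eval_mult)
      then show ?thesis by (simp only: form ws eval_at_affine_rpoly)
    qed
    ultimately show "\<exists>\<sigma> :: ('n + 'p) rpoly. sum_of_squares \<sigma> \<and> degree_le 2 \<sigma> \<and>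
      (\<forall>x z. - f x z = eval_at x z \<sigma>)"
      by blast
  qed
qed

text \<open>
  The constraint function \<open>g\<close> enters only through the fact that its multiplier term is quadratic;
  this covers \<open>q = 2\<close> and \<open>q = \<infinity>\<close> at once.
\<close>

lemma sos_sdp_equivalent:
  fixes g :: "real^'n \<Rightarrow> 's::ordered_euclidean_space"
    and W :: "real^'p^'p" and C :: "real^'p^'k"
  assumes g: "\<And>\<sigma>1. quadratic_fun (\<lambda>x (z :: real^'p). \<sigma>1 \<bullet> g (x - x0))"
  shows "equivalent_via_log (sos_problem g x0 W U u C c) (sdp_problem g x0 W U u C c)"
proof -
  have "(\<exists>\<sigma>0 :: ('n + 'p) rpoly. sum_of_squares \<sigma>0 \<and> degree_le 2 \<sigma>0 \<and>
          (\<forall>x z. 1 - (norm (Q *v (C *v z + c) + b))\<^sup>2 =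
             eval_at x z \<sigma>0 + multiplier_terms g x0 W U u \<sigma>1 \<sigma>2 \<sigma>3 \<tau> x z))
    \<longleftrightarrow> psd (- gram_matrix (\<lambda>x z. (norm (Q *v (C *v z + c) + b))\<^sup>2 - 1
          + multiplier_terms g x0 W U u \<sigma>1 \<sigma>2 \<sigma>3 \<tau> x z))"
    for Q :: "real^'k^'k" and b \<sigma>1 \<sigma>2 \<sigma>3 \<tau>
  proof -
    let ?f = "\<lambda>x z. (norm (Q *v (C *v z + c) + b))\<^sup>2 - 1
      + multiplier_terms g x0 W U u \<sigma>1 \<sigma>2 \<sigma>3 \<tau> x z"
    have "affine_fun (\<lambda>(x :: real^'n) z. (Q *v (C *v z + c) + b) $ i)" for i
      by (simp add: matrix_vector_mult_def) (intro affine_fun_intros)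
    then have "quadratic_fun ?f"
      by (intro quadratic_fun_add quadratic_fun_diff quadratic_fun_norm_sq
          quadratic_fun_multiplier_terms g quadratic_fun_affine[OF affine_fun_const])
    note iff = sos_representation_iff_psd[OF this]
    have "1 - (norm (Q *v (C *v z + c) + b))\<^sup>2
        = e + multiplier_terms g x0 W U u \<sigma>1 \<sigma>2 \<sigma>3 \<tau> x z \<longleftrightarrow> - ?f x z = e" for x z e
      by linarith
    then show ?thesis by (simp only: iff)
  qed
  then have "feasible (sos_problem g x0 W U u C c) = feasible (sdp_problem g x0 W U u C c)"
    unfolding sos_problem_def sdp_problem_def by (simp only: max_problem.select_convs)
  moreover have "0 \<le> objective (sos_problem g x0 W U u C c) t
      \<and> objective (sdp_problem g x0 W U u C c) t = ext_log (objective (sos_problem g x0 W U u C c) t)"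
    if "t \<in> feasible (sos_problem g x0 W U u C c)" for t
  proof -
    obtain Q r where t: "t = (Q, r)" by (cases t)
    with that have "psd Q" by (simp add: sos_problem_def split: prod.splits)
    then show ?thesis
      by (simp add: t sos_problem_def sdp_problem_def psd_det_nonneg split: prod.split)
  qed
  ultimately show ?thesis by (simp only: equivalent_via_log_def) blast
qed

theorem lemma2:
  fixes W :: "real^'p^'p" and U :: "real^'n^'p" and u :: "real^'p"
    and C :: "real^'p^'k" and c :: "real^'k" and F :: "real^'n \<Rightarrow> real^'k"
    and x0 :: "real^'n" and \<epsilon> :: real
  assumes "monDEQ W U u C c F" and "\<epsilon> > 0"
  shows "equivalent_via_log (sos_problem (g_2 \<epsilon>) x0 W U u C c) (sdp_problem (g_2 \<epsilon>) x0 W U u C c)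
    \<and> equivalent_via_log (sos_problem (g_inf \<epsilon>) x0 W U u C c) (sdp_problem (g_inf \<epsilon>) x0 W U u C c)"
  by (intro conjI sos_sdp_equivalent quadratic_fun_g_2 quadratic_fun_g_inf)

end
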